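(* Let $p$ be a propositional variable. There is no formula $\phi\in\mathcal{L}_\Box$ that defines $\blacktriangle p$ on the class of all frames; likewise none on the class of all reflexive frames, of all transitive frames, of all symmetric frames, or of all Euclidean frames.
   Context: Formulas are built from a countable set $\mathsf{Var}$ of variables; $\mathcal{L}_\blacktriangle$ uses $\neg,\wedge,\vee,\blacktriangle$ and $\mathcal{L}_\Box$ uses $\neg,\wedge,\vee,\Box$. A frame is $\langle W,R\rangle$, $W\neq\varnothing$, $R\subseteq W^2$; a model is $\langle W,R,v^+,v^-\rangle$ with independent $v^+,v^-:\mathsf{Var}\to 2^W$; a pointed model is a model with a state. $w\vDash^+p$ iff $w\in v^+(p)$; $w\vDash^-p$ iff $w\in v^-(p)$; $\neg$ swaps $\vDash^+$ and $\vDash^-$; $\wedge$: true iff both true, false iff some false; $\vee$: true iff some true, false iff both false. $w\vDash^+\Box\phi$ iff every $R$-successor $w'$ of $w$ has $w'\vDash^+\phi$; $w\vDash^-\Box\phi$ iff some $R$-successor $w'$ has $w'\vDash^-\phi$. $w_0\vDash^+\blacktriangle\phi$ iff for all $R$-successors $w_1,w_2$ of $w_0$, ($w_1\vDash^+\phi\Rightarrow w_2\vDash^+\phi$) and ($w_1\vDash^-\phi\Rightarrow w_2\vDash^-\phi$), and every $R$-successor $w_1$ has $w_1\vDash^+\phi$ or $w_1\vDash^-\phi$. $w_0\vDash^-\blacktriangle\phi$ iff there are successors $w_1,w_2$ of $w_0$ with ($w_1\vDash^+\phi$, $w_2\nvDash^+\phi$) or ($w_1\vDash^-\phi$, $w_2\nvDash^-\phi$)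 or ($w_1\vDash^+\phi$, $w_2\vDash^-\phi$). A formula $\phi$ of one language defines a formula $\chi$ of another in a class $\mathbb{K}$ of frames iff for every $\mathfrak{F}\in\mathbb{K}$ and every pointed model $\langle\mathfrak{M},w\rangle$ on $\mathfrak{F}$: $\mathfrak{M},w\vDash^+\phi$ iff $\mathfrak{M},w\vDash^+\chi$, and $\mathfrak{M},w\vDash^-\phi$ iff $\mathfrak{M},w\vDash^-\chi$. *)

theory Defs
  imports Main "HOL-Library.Countable"
begin

text \<open>
  Both languages live in one datatype, so that they share a single semantics;
  the two languages are carved out as subsets.
\<close>

datatype 'v fm =
    Var 'v
  | Neg "'v fm"
  | And "'v fm" "'v fm"
  | Or "'v fm" "'v fm"
  | Box "'v fm"
  | Tri "'v fm"

inductive_set lang_tri :: "'v fm set" where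
  "Var p \<in> lang_tri"
| "\<phi> \<in> lang_tri \<Longrightarrow> Neg \<phi> \<in> lang_tri"
| "\<phi> \<in> lang_tri \<Longrightarrow> \<psi> \<in> lang_tri \<Longrightarrow> And \<phi> \<psi> \<in> lang_tri"
| "\<phi> \<in> lang_tri \<Longrightarrow> \<psi> \<in> lang_tri \<Longrightarrow> Or \<phi> \<psi> \<in> lang_tri"
| "\<phi> \<in> lang_tri \<Longrightarrow> Tri \<phi> \<in> lang_tri"

inductive_set lang_box :: "'v fm set" where
  "Var p \<in> lang_box"
| "\<phi> \<in> lang_box \<Longrightarrow> Neg \<phi> \<in> lang_box"
| "\<phi> \<in> lang_box \<Longrightarrow> \<psi> \<in> lang_box \<Longrightarrow> And \<phi> \<psi> \<in> lang_box"
| "\<phi> \<in> lang_box \<Longrightarrow> \<psi> \<in> lang_box \<Longrightarrow> Or \<phi> \<psi> \<in> lang_box"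
| "\<phi> \<in> lang_box \<Longrightarrow> Box \<phi> \<in> lang_box"

record 'w frame =
  states :: "'w set"
  acc :: "'w rel"

record ('w, 'v) model = "'w frame" +
  vpos :: "'v \<Rightarrow> 'w set"
  vneg :: "'v \<Rightarrow> 'w set"

definition is_frame :: "'w frame \<Rightarrow> bool" where
  "is_frame F \<longleftrightarrow> states F \<noteq> {} \<and> acc F \<subseteq> states F \<times> states F"

definition model_on :: "'w frame \<Rightarrow> ('w, 'v) model \<Rightarrow> bool" where
  "model_on F M \<longleftrightarrow> states M = states F \<and> acc M = acc F
     \<and> (\<forall>p. vpos M p \<subseteq> states F \<and> vneg M p \<subseteq> states F)"

fun sat_pos :: "('w, 'v) model \<Rightarrow> 'w \<Rightarrow> 'v fm \<Rightarrow> bool"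
and sat_neg :: "('w, 'v) model \<Rightarrow> 'w \<Rightarrow> 'v fm \<Rightarrow> bool" where
  "sat_pos M w (Var p) \<longleftrightarrow> w \<in> vpos M p"
| "sat_pos M w (Neg \<phi>) \<longleftrightarrow> sat_neg M w \<phi>"
| "sat_pos M w (And \<phi> \<psi>) \<longleftrightarrow> sat_pos M w \<phi> \<and> sat_pos M w \<psi>"
| "sat_pos M w (Or \<phi> \<psi>) \<longleftrightarrow> sat_pos M w \<phi> \<or> sat_pos M w \<psi>"
| "sat_pos M w (Box \<phi>) \<longleftrightarrow> (\<forall>w'. (w, w') \<in> acc M \<longrightarrow> sat_pos M w' \<phi>)"
| "sat_pos M w (Tri \<phi>) \<longleftrightarrow>
     (\<forall>w1 w2. (w, w1) \<in> acc M \<and> (w, w2) \<in> acc M \<longrightarrow>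
        (sat_pos M w1 \<phi> \<longrightarrow> sat_pos M w2 \<phi>) \<and> (sat_neg M w1 \<phi> \<longrightarrow> sat_neg M w2 \<phi>))
     \<and> (\<forall>w1. (w, w1) \<in> acc M \<longrightarrow> sat_pos M w1 \<phi> \<or> sat_neg M w1 \<phi>)"
| "sat_neg M w (Var p) \<longleftrightarrow> w \<in> vneg M p"
| "sat_neg M w (Neg \<phi>) \<longleftrightarrow> sat_pos M w \<phi>"
| "sat_neg M w (And \<phi> \<psi>) \<longleftrightarrow> sat_neg M w \<phi> \<or> sat_neg M w \<psi>"
| "sat_neg M w (Or \<phi> \<psi>) \<longleftrightarrow> sat_neg M w \<phi> \<and> sat_neg M w \<psi>"
| "sat_neg M w (Box \<phi>) \<longleftrightarrow> (\<exists>w'. (w, w') \<in> acc M \<and> sat_neg M w' \<phi>)"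
| "sat_neg M w (Tri \<phi>) \<longleftrightarrow>
     (\<exists>w1 w2. (w, w1) \<in> acc M \<and> (w, w2) \<in> acc M \<and>
        (sat_pos M w1 \<phi> \<and> \<not> sat_pos M w2 \<phi>
         \<or> sat_neg M w1 \<phi> \<and> \<not> sat_neg M w2 \<phi>
         \<or> sat_pos M w1 \<phi> \<and> sat_neg M w2 \<phi>))"

definition defines_in :: "'w frame set \<Rightarrow> 'v fm \<Rightarrow> 'v fm \<Rightarrow> bool" where
  "defines_in K \<phi> \<chi> \<longleftrightarrow>
     (\<forall>F \<in> K. \<forall>M. model_on F M \<longrightarrow> (\<forall>w \<in> states F.
        (sat_pos M w \<phi> \<longleftrightarrow> sat_pos M w \<chi>) \<and> (sat_neg M w \<phi> \<longleftrightarrow> sat_neg M w \<chi>)))"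

text \<open>
  Frame classes are relative to the type of states. A class contains frames on arbitrary
  nonempty subsets of that type, so an infinite type hosts copies of all countable frames.
\<close>

definition all_frames :: "'w frame set" where
  "all_frames = {F. is_frame F}"

definition reflexive_frames :: "'w frame set" where
  "reflexive_frames = {F. is_frame F \<and> refl_on (states F) (acc F)}"

definition transitive_frames :: "'w frame set" where
  "transitive_frames = {F. is_frame F \<and> trans (acc F)}"

definition symmetric_frames :: "'w frame set" where
  "symmetric_frames = {F. is_frame F \<and> sym (acc F)}"

definition euclidean :: "'w rel \<Rightarrow> bool" where
  "euclidean R \<longleftrightarrow> (\<forall>x y z. (x, y) \<in> R \<and> (x, z) \<in> R \<longrightarrow> (y, z) \<in> R)"

definition euclidean_frames :: "'w frame set" where
  "euclidean_frames = {F. is_frame F \<and> euclidean (acc F)}"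

end

theory Submission
  imports Defs
begin

text \<open>
  Formulas with \<open>\<box>\<close> as their only modality are monotone: enlarging \<open>v\<^sup>+\<close> and \<open>v\<^sup>-\<close> preserves
  both truth and falsity. The formula \<open>\<triangle>p\<close> is not monotone. Take two states that see each other
  and themselves, with \<open>p\<close> true and not false at both; then \<open>\<triangle>p\<close> is true, and it
  ceases to be true once \<open>p\<close> is in addition made false at exactly one of the states. This frame is
  an equivalence relation, so it belongs to all five classes.
\<close>

text \<open>No clause for a connective of \<open>lang_box\<close> negates \<open>sat_pos\<close> or
  \<open>sat_neg\<close>. Truth and falsity share one induction because \<open>Neg\<close> swaps
  them.\<close>

lemma lang_box_monotone:
  assumes "\<phi> \<in> lang_box" and "acc N = acc M"
    and "\<And>q. vpos M q \<subseteq> vpos N q" and "\<And>q. vneg M q \<subseteq> vneg N q"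
  shows "(sat_pos M w \<phi> \<longrightarrow> sat_pos N w \<phi>) \<and> (sat_neg M w \<phi> \<longrightarrow> sat_neg N w \<phi>)"
  using assms(1)
proof (induction arbitrary: w)
  case (1 q)
  show ?case using assms(3,4)[of q] by auto
qed (use assms(2) in auto)

text \<open>With \<open>K\<close> arbitrary, a single frame settles all five classes.\<close>

lemma Tri_not_definable_if_total_frame:
  fixes a b :: 'w and p :: 'v
  assumes "a \<noteq> b" and "\<lparr>states = {a, b}, acc = {a, b} \<times> {a, b}\<rparr> \<in> K"
  shows "\<not> (\<exists>\<phi> \<in> lang_box. defines_in K \<phi> (Tri (Var p)))"
proof
  assume "\<exists>\<phi> \<in> lang_box. defines_in K \<phi> (Tri (Var p))"
  then obtain \<phi> where \<phi>: "\<phi> \<in> lang_box" "defines_in K \<phi> (Tri (Var p))" by blast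
  let ?F = "\<lparr>states = {a, b}, acc = {a, b} \<times> {a, b}\<rparr>"
  define M :: "'w set \<Rightarrow> ('w, 'v) model" where "M V = \<lparr>states = {a, b}, acc = {a, b} \<times> {a, b},
    vpos = \<lambda>_. {a, b}, vneg = \<lambda>_. V\<rparr>" for V
  have equiv: "sat_pos (M V) a \<phi> \<longleftrightarrow> sat_pos (M V) a (Tri (Var p))" if "V \<subseteq> {a, b}" for V
  proof -
    have "model_on ?F (M V)" using that by (simp add: model_on_def M_def)
    then show ?thesis using \<phi>(2) assms(2) unfolding defines_in_def by force
  qed
  have "sat_pos (M {}) a \<phi>" by (subst equiv) (auto simp: M_def)
  moreover have "sat_pos (M {}) a \<phi> \<longrightarrow> sat_pos (M {a}) a \<phi>"
    using lang_box_monotone[OF \<phi>(1), of "M {a}" "M {}"] by (simp add: M_def)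
  \<comment> \<open>In \<open>M {a}\<close>, \<open>a\<close> sees itself, where \<open>p\<close> is
    false, and \<open>b\<close>, where it is not.\<close>
  moreover have "\<not> sat_pos (M {a}) a \<phi>"
    using assms(1) by (subst equiv) (auto simp: M_def)
  ultimately show False by blast
qed

theorem theorem4:
  fixes p :: "'v::countable"
  assumes "infinite (UNIV :: 'w set)"
  shows "\<not> (\<exists>\<phi> \<in> lang_box. defines_in (all_frames :: 'w frame set) \<phi> (Tri (Var p)))
    \<and> \<not> (\<exists>\<phi> \<in> lang_box. defines_in (reflexive_frames :: 'w frame set) \<phi> (Tri (Var p)))
    \<and> \<not> (\<exists>\<phi> \<in> lang_box. defines_in (transitive_frames :: 'w frame set) \<phi> (Tri (Var p)))
    \<and> \<not> (\<exists>\<phi> \<in> lang_box. defines_in (symmetric_frames :: 'w frame set) \<phi> (Tri (Var p)))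
    \<and> \<not> (\<exists>\<phi> \<in> lang_box. defines_in (euclidean_frames :: 'w frame set) \<phi> (Tri (Var p)))"
proof -
  \<comment> \<open>One of the two states is \<open>undefined\<close>; infinity of the type supplies
    the other.\<close>
  obtain a b :: 'w where "a \<noteq> b"
    using ex_new_if_finite[OF assms, of "{undefined}"] by auto
  note undefinable = Tri_not_definable_if_total_frame[OF this]
  let ?F = "\<lparr>states = {a, b}, acc = {a, b} \<times> {a, b}\<rparr>"
  have "?F \<in> all_frames"
    by (simp add: all_frames_def is_frame_def)
  moreover have "?F \<in> reflexive_frames"
    by (simp add: reflexive_frames_def is_frame_def refl_on_def)
  moreover have "?F \<in> transitive_frames"
    unfolding transitive_frames_def is_frame_def trans_def by simp
  moreover have "?F \<in> symmetric_frames"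
    unfolding symmetric_frames_def is_frame_def sym_def by simp
  moreover have "?F \<in> euclidean_frames"
    unfolding euclidean_frames_def is_frame_def euclidean_def by (simp, blast)
  ultimately show ?thesis
    by (intro conjI undefinable)
qed

end
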